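(* Let $k\ge 2$ be a fixed integer. For each $n$ let $p=p_n\in(0,1)$ and let $T$ be a random order-$k$ tensor of dimension $n\times\cdots\times n$ with independent Bernoulli entries satisfying $\mathbb{E}T_{i_1,\dots,i_k}=p$ for all $i_1,\dots,i_k\in[n]$. Assume that $p=o(1)$ and $np\to\infty$ as $n\to\infty$. Then with high probability (i.e. with probability tending to $1$ as $n\to\infty$), $$\|T-\mathbb{E}T\|\ge\sqrt{np}.$$
   Context: $[n]=\{1,\dots,n\}$. For a real order-$k$ tensor $T$ of dimension $n\times\cdots\times n$ the spectral norm is $$\|T\|:=\sup_{\|x_1\|_2=\cdots=\|x_k\|_2=1}\Big|\sum_{i_1,\dots,i_k\in[n]}t_{i_1,\dots,i_k}x_{1,i_1}\cdots x_{k,i_k}\Big|,$$ the supremum being over unit vectors $x_1,\dots,x_k\in\mathbb{R}^n$. Expectations of tensors are entrywise. *)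

theory Defs
  imports "HOL-Probability.Probability"
begin

(* An order-k tensor of dimension n x ... x n is a real function on multi-indices; only its
   values on multi_indices k n matter.  Multi-indices are extensional functions, so that each
   element of [n]^k occurs exactly once. *)
definition multi_indices :: "nat \<Rightarrow> nat \<Rightarrow> (nat \<Rightarrow> nat) set" where
  "multi_indices k n = ({1..k} \<rightarrow>\<^sub>E {1..n})"

definition multilinear_form ::
    "nat \<Rightarrow> nat \<Rightarrow> ((nat \<Rightarrow> nat) \<Rightarrow> real) \<Rightarrow> (nat \<Rightarrow> nat \<Rightarrow> real) \<Rightarrow> real" where
  "multilinear_form k n t x = (\<Sum>i\<in>multi_indices k n. t i * (\<Prod>j=1..k. x j (i j)))"

(* The vector x j in R^n is represented by its coordinates x j 1, ..., x j n.  For n >= 1 the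
   supremum is over a nonempty bounded set; for n = 0 and k >= 1 it has no meaning. *)
definition spectral_norm :: "nat \<Rightarrow> nat \<Rightarrow> ((nat \<Rightarrow> nat) \<Rightarrow> real) \<Rightarrow> real" where
  "spectral_norm k n t =
     (SUP x \<in> {x. \<forall>j\<in>{1..k}. L2_set (x j) {1..n} = 1}. \<bar>multilinear_form k n t x\<bar>)"

definition bernoulli_var :: "'a measure \<Rightarrow> real \<Rightarrow> ('a \<Rightarrow> real) \<Rightarrow> bool" where
  "bernoulli_var M q X \<longleftrightarrow> X \<in> borel_measurable M \<and>
     distr M borel X = distr (measure_pmf (bernoulli_pmf q)) borel of_bool"

lemma expectation_bernoulli_var:
  assumes "bernoulli_var M q X" "0 \<le> q" "q \<le> 1"
  shows "(\<integral>\<omega>. X \<omega> \<partial>M) = q"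
proof -
  have "(\<integral>\<omega>. X \<omega> \<partial>M) = (\<integral>y. y \<partial>distr M borel X)"
    using assms(1) by (subst integral_distr) (auto simp: bernoulli_var_def)
  also have "\<dots> = (\<integral>y. y \<partial>distr (measure_pmf (bernoulli_pmf q)) borel of_bool)"
    using assms(1) by (simp add: bernoulli_var_def)
  also have "\<dots> = (\<integral>b. of_bool b \<partial>measure_pmf (bernoulli_pmf q))"
    by (subst integral_distr) auto
  also have "\<dots> = q"
    using assms(2,3) by simp
  finally show ?thesis .
qed

end

theory Submission
  imports Defs
begin

text \<open>Restricting to a two-dimensional slice gives an \<open>n \<times> n\<close> matrix \<open>A\<close> of centered entries. A single row
  has squared norm about \<open>n p (1 - p)\<close>, which falls just short of \<open>n p\<close>. Take instead the normalised
  indicator \<open>x\<close> of the support \<open>S\<close> of the first row: the first coordinate of \<open>A x\<close> contributes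
  \<open>\<bar>S\<bar> (1 - p)\<^sup>2\<close>, about \<open>n p\<close>, to its squared norm, and the other rows, being independent of \<open>S\<close>,
  contribute about \<open>n p\<close> more. Chebyshev's inequality shows that the total exceeds \<open>n p\<close> with high
  probability.\<close>

section \<open>Boundedness and measurability of the spectral norm\<close>

lemma form_abs_le:
  assumes "\<forall>j\<in>{1..k}. L2_set (x j) {1..n} = 1"
  shows "\<bar>multilinear_form k n t x\<bar> \<le> (\<Sum>i\<in>multi_indices k n. \<bar>t i\<bar>)"
proof -
  \<comment> \<open>A coordinate of a unit vector is at most its norm, so the products of
    coordinates in the form are at most 1 in absolute value.\<close>
  have coord: "\<bar>x j a\<bar> \<le> 1" if "j \<in> {1..k}" "a \<in> {1..n}" for j a
    using member_le_L2_set[of "{1..n}" a "\<lambda>b. \<bar>x j b\<bar>"] assms that by (simp add: L2_set_def)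
  have "\<bar>t i * (\<Prod>j=1..k. x j (i j))\<bar> \<le> \<bar>t i\<bar>" if "i \<in> multi_indices k n" for i
  proof -
    have "i j \<in> {1..n}" if "j \<in> {1..k}" for j
      using \<open>i \<in> multi_indices k n\<close> that by (auto simp: multi_indices_def PiE_iff)
    then have "(\<Prod>j=1..k. \<bar>x j (i j)\<bar>) \<le> 1"
      by (intro prod_le_1) (use coord in auto)
    then show ?thesis
      by (simp add: abs_mult abs_prod mult_left_le)
  qed
  then show ?thesis
    unfolding multilinear_form_def by (intro order_trans[OF sum_abs] sum_mono)
qed

text \<open>A supremum of reals carries information only for a set that is bounded above. The crude
  entrywise bound is enough, since its size never enters the final estimate.\<close>

lemma bdd_above_form:
  "bdd_above ((\<lambda>x. \<bar>multilinear_form k n t x\<bar>) ` {x. \<forall>j\<in>{1..k}. L2_set (x j) {1..n} = 1})"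
  by (rule bdd_aboveI2[where M = "\<Sum>i\<in>multi_indices k n. \<bar>t i\<bar>"]) (auto intro: form_abs_le)

lemma L2_set_indicator:
  assumes "finite A" "a \<in> A"
  shows "L2_set (\<lambda>b. of_bool (b = a)) A = 1"
proof -
  have "(\<Sum>b\<in>A. (of_bool (b = a) :: real)\<^sup>2) = 1"
    using assms by (subst sum.mono_neutral_right[where S = "{a}"]) auto
  then show ?thesis by (simp add: L2_set_def)
qed

lemma finite_multi_indices: "finite (multi_indices k n)"
  by (auto simp: multi_indices_def intro: finite_PiE)

lemma less_spectral_norm_iff:
  assumes "n \<ge> 1"
  shows "c < spectral_norm k n t \<longleftrightarrow>
    (\<exists>x. (\<forall>j\<in>{1..k}. L2_set (x j) {1..n} = 1) \<and> c < \<bar>multilinear_form k n t x\<bar>)"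
proof -
  have "\<exists>x :: nat \<Rightarrow> nat \<Rightarrow> real. \<forall>j\<in>{1..k}. L2_set (x j) {1..n} = 1"
    by (rule exI[of _ "\<lambda>j b. of_bool (b = 1)"])
      (use L2_set_indicator[of "{1..n}" "1 :: nat"] assms in auto)
  then have "{x :: nat \<Rightarrow> nat \<Rightarrow> real. \<forall>j\<in>{1..k}. L2_set (x j) {1..n} = 1} \<noteq> {}"
    by auto
  then show ?thesis
    unfolding spectral_norm_def by (subst less_cSUP_iff[OF _ bdd_above_form]) auto
qed

text \<open>The supremum runs over uncountably many vectors, but its strict superlevel sets are open in
  the coordinates of the tensor.\<close>

lemma spectral_norm_measurable:
  assumes "n \<ge> 1" and X: "\<And>i. i \<in> multi_indices k n \<Longrightarrow> X i \<in> borel_measurable M"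
  shows "(\<lambda>\<omega>. spectral_norm k n (\<lambda>i. X i \<omega>)) \<in> borel_measurable M"
proof (rule borel_measurableI_greater)
  fix c :: real
  obtain e where e: "bij_betw e {0..<card (multi_indices k n)} (multi_indices k n)"
    using ex_bij_betw_nat_finite[OF finite_multi_indices] by blast
  define N where "N = card (multi_indices k n)"
  \<comment> \<open>The entries are listed as a sequence padded with zeros. Over the countable index
    type \<open>nat\<close> the Borel sets of the product topology are the product-measurable sets,
    so coordinatewise measurability of \<open>Z\<close> suffices; the type of multi-indices is
    uncountable.\<close>
  define Z :: "_ \<Rightarrow> nat \<Rightarrow> real" where "Z = (\<lambda>\<omega> m. if m < N then X (e m) \<omega> else 0)"
  define g where "g = (\<lambda>x (z :: nat \<Rightarrow> real). \<bar>\<Sum>m<N. z m * (\<Prod>j=1..k. x j (e m j))\<bar> :: real)"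
  define U where
    "U = (\<Union>x\<in>{x. \<forall>j\<in>{1..k}. L2_set (x j) {1..n} = 1}. {z. c < g x z})"
  have form: "\<bar>multilinear_form k n (\<lambda>i. X i \<omega>) x\<bar> = g x (Z \<omega>)" for x \<omega>
  proof -
    have "(\<Sum>i\<in>multi_indices k n. X i \<omega> * (\<Prod>j=1..k. x j (i j))) =
        (\<Sum>m\<in>{0..<N}. X (e m) \<omega> * (\<Prod>j=1..k. x j (e m j)))"
      using sum.reindex_bij_betw[OF e, of "\<lambda>i. X i \<omega> * (\<Prod>j=1..k. x j (i j))"]
      by (simp add: N_def)
    then show ?thesis
      by (simp add: multilinear_form_def g_def Z_def atLeast0LessThan)
  qed
  have "continuous_on UNIV (g x)" for x
    unfolding g_def by (intro continuous_intros continuous_on_product_coordinates)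
  then have "open U"
    unfolding U_def by (intro open_UN ballI open_Collect_less) auto
  have "X (e m) \<in> borel_measurable M" if "m < N" for m
    using X bij_betwE[OF e] that by (auto simp: N_def)
  then have "(\<lambda>\<omega>. Z \<omega> m) \<in> borel_measurable M" for m
    by (cases "m < N") (auto simp: Z_def)
  then have "Z \<in> measurable M (PiM UNIV (\<lambda>_. borel))"
    by (intro measurable_PiM_single') auto
  then have "Z \<in> borel_measurable M"
    by (subst (asm) measurable_cong_sets[OF refl sets_PiM_equal_borel])
  then have "Z -` U \<inter> space M \<in> sets M"
    using \<open>open U\<close> by (intro measurable_sets[of _ _ borel]) auto
  also have "Z -` U \<inter> space M = {\<omega> \<in> space M. c < spectral_norm k n (\<lambda>i. X i \<omega>)}"
    by (auto simp: U_def form less_spectral_norm_iff[OF assms(1)])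
  finally show "{\<omega> \<in> space M. c < spectral_norm k n (\<lambda>i. X i \<omega>)} \<in> sets M" .
qed

section \<open>Matrix slices of a tensor\<close>

text \<open>All coordinates from the third on are frozen at 1. The restricted abstraction makes the
  function extensional, as membership in \<open>multi_indices\<close> demands.\<close>

definition slice_index :: "nat \<Rightarrow> nat \<Rightarrow> nat \<Rightarrow> nat \<Rightarrow> nat" where
  "slice_index k a b = (\<lambda>j\<in>{1..k}. if j = 1 then a else if j = 2 then b else 1)"

lemma slice_index_mem:
  assumes "a \<in> {1..n}" "b \<in> {1..n}"
  shows "slice_index k a b \<in> multi_indices k n"
  using assms by (auto simp: slice_index_def multi_indices_def)

lemma inj_slice_index:
  assumes "k \<ge> 2"
  shows "inj_on (\<lambda>(a, b). slice_index k a b) A"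
proof (rule inj_onI, clarify)
  fix a b a' b'
  assume "slice_index k a b = slice_index k a' b'"
  from fun_cong[OF this, of 1] fun_cong[OF this, of 2] show "a = a' \<and> b = b'"
    using assms by (simp add: slice_index_def)
qed

text \<open>The first standard basis vector in positions 3 to \<open>k\<close> annihilates every
  multi-index off the slice, which leaves the bilinear form of a matrix.\<close>

lemma form_slice:
  assumes "k \<ge> 2" "n \<ge> 1"
  shows "multilinear_form k n t (\<lambda>j. if j = 1 then y else if j = 2 then x else (\<lambda>b. of_bool (b = 1))) =
    (\<Sum>a=1..n. \<Sum>b=1..n. t (slice_index k a b) * y a * x b)"
    (is "multilinear_form k n t ?v = _")
proof -
  let ?s = "\<lambda>(a, b). slice_index k a b"
  have split: "{1..k} = {1, 2} \<union> {3..k}"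
    using assms(1) by auto
  have prod: "(\<Prod>j=1..k. ?v j (i j)) = y (i 1) * x (i 2) * (\<Prod>j=3..k. of_bool (i j = 1))" for i
  proof -
    have "(\<Prod>j=1..k. ?v j (i j)) = (\<Prod>j\<in>{1,2}. ?v j (i j)) * (\<Prod>j=3..k. ?v j (i j))"
      unfolding split by (rule prod.union_disjoint) auto
    also have "(\<Prod>j=3..k. ?v j (i j)) = (\<Prod>j=3..k. of_bool (i j = 1))"
      by (rule prod.cong) auto
    finally show ?thesis by simp
  qed
  have zero: "t i * (\<Prod>j=1..k. ?v j (i j)) = 0"
    if "i \<in> multi_indices k n - ?s ` ({1..n} \<times> {1..n})" for i
  proof -
    have i: "i \<in> {1..k} \<rightarrow>\<^sub>E {1..n}"
      using that by (simp add: multi_indices_def)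
    \<comment> \<open>If all these coordinates were 1, extensionality would force \<open>i\<close>
      to be a slice index.\<close>
    have "\<exists>j\<in>{3..k}. i j \<noteq> 1"
    proof (rule ccontr)
      assume "\<not> ?thesis"
      then have "i = slice_index k (i 1) (i 2)"
        using i by (force simp: slice_index_def PiE_iff extensional_def)
      moreover have "i 1 \<in> {1..n}" "i 2 \<in> {1..n}"
        using i assms(1) by (auto simp: PiE_iff)
      ultimately have "i \<in> ?s ` ({1..n} \<times> {1..n})"
        by (intro image_eqI[of _ _ "(i 1, i 2)"]) auto
      with that show False by simp
    qed
    then have "(\<Prod>j=3..k. of_bool (i j = 1) :: real) = 0"
      by (intro prod_zero) auto
    then show ?thesis unfolding prod by simp
  qed
  have "multilinear_form k n t ?v = (\<Sum>i\<in>?s ` ({1..n} \<times> {1..n}). t i * (\<Prod>j=1..k. ?v j (i j)))"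
    unfolding multilinear_form_def
    by (rule sum.mono_neutral_right[OF finite_multi_indices])
      (use zero slice_index_mem in auto)
  also have "\<dots> = (\<Sum>(a, b)\<in>{1..n} \<times> {1..n}. t (slice_index k a b) * y a * x b)"
  proof (subst sum.reindex[OF inj_slice_index[OF assms(1)]], rule sum.cong, simp, clarify)
    fix a b
    have "(\<Prod>j=3..k. of_bool (slice_index k a b j = 1) :: real) = 1"
      by (intro prod.neutral) (auto simp: slice_index_def)
    moreover have "slice_index k a b 1 = a" "slice_index k a b 2 = b"
      using assms(1) by (auto simp: slice_index_def)
    ultimately show "((\<lambda>i. t i * (\<Prod>j=1..k. ?v j (i j))) \<circ> ?s) (a, b) =
        t (slice_index k a b) * y a * x b"
      unfolding comp_def split prod by simp
  qed
  finally show ?thesis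
    by (simp add: sum.cartesian_product)
qed

text \<open>Write A for the slice matrix. For fixed \<open>x\<close> the bilinear form is the inner
  product of \<open>y\<close> with A x, and the choice of \<open>y\<close> as the normalised A x
  turns it into the norm of A x.\<close>

lemma spectral_norm_ge_slice:
  assumes "k \<ge> 2" "n \<ge> 1" and x: "L2_set x {1..n} = 1"
  shows "L2_set (\<lambda>a. \<Sum>b=1..n. t (slice_index k a b) * x b) {1..n} \<le> spectral_norm k n t"
    (is "?L \<le> _")
proof -
  define v where "v = (\<lambda>a. \<Sum>b=1..n. t (slice_index k a b) * x b)"
  have bound: "\<bar>\<Sum>a=1..n. v a * y a\<bar> \<le> spectral_norm k n t" if y: "L2_set y {1..n} = 1" for y
  proof -
    let ?v = "\<lambda>j. if j = 1 then y else if j = 2 then x else (\<lambda>b. of_bool (b = (1::nat)))"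
    have "\<bar>multilinear_form k n t ?v\<bar> \<le> spectral_norm k n t"
      unfolding spectral_norm_def using x y L2_set_indicator[of "{1..n}" 1] assms(2)
      by (intro cSUP_upper[OF _ bdd_above_form]) auto
    then show ?thesis
      unfolding form_slice[OF assms(1,2)] by (simp add: v_def sum_distrib_left sum_distrib_right mult_ac)
  qed
  show ?thesis
  \<comment> \<open>A zero vector cannot be normalised; then only nonnegativity of the spectral norm
    is at stake, and any unit vector shows it.\<close>
  proof (cases "L2_set v {1..n} = 0")
    case True
    with bound[OF L2_set_indicator[of "{1..n}" 1]] assms(2) show ?thesis by (simp add: v_def)
  next
    case False
    define y where "y = (\<lambda>a. v a / L2_set v {1..n})"
    have pos: "L2_set v {1..n} > 0" using False L2_set_nonneg[of v "{1..n}"] by linarith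
    have sq: "(\<Sum>a=1..n. (v a)\<^sup>2) = (L2_set v {1..n})\<^sup>2"
      by (simp add: L2_set_def sum_nonneg)
    have "L2_set y {1..n} = 1"
    proof -
      have "(\<Sum>a=1..n. (y a)\<^sup>2) = (\<Sum>a=1..n. (v a)\<^sup>2) / (L2_set v {1..n})\<^sup>2"
        by (simp add: y_def power_divide sum_divide_distrib)
      then have "(\<Sum>a=1..n. (y a)\<^sup>2) = 1"
        using pos unfolding sq by simp
      then show ?thesis by (simp add: L2_set_def)
    qed
    moreover have "(\<Sum>a=1..n. v a * y a) = L2_set v {1..n}"
    proof -
      have "(\<Sum>a=1..n. v a * y a) = (\<Sum>a=1..n. (v a)\<^sup>2) / L2_set v {1..n}"
        by (simp add: y_def power2_eq_square sum_divide_distrib)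
      then show ?thesis using pos unfolding sq by (simp add: power2_eq_square)
    qed
    ultimately show ?thesis using bound[of y] by (simp add: v_def)
  qed
qed

section \<open>Bernoulli variables\<close>

lemma bernoulli_var_integral:
  fixes f :: "real \<Rightarrow> real"
  assumes "bernoulli_var M q X" "0 \<le> q" "q \<le> 1" and f: "f \<in> borel_measurable borel"
  shows "(\<integral>\<omega>. f (X \<omega>) \<partial>M) = q * f 1 + (1 - q) * f 0"
proof -
  have "(\<integral>\<omega>. f (X \<omega>) \<partial>M) = (\<integral>y. f y \<partial>distr M borel X)"
    using assms(1) f by (subst integral_distr) (auto simp: bernoulli_var_def)
  also have "\<dots> = (\<integral>y. f y \<partial>distr (measure_pmf (bernoulli_pmf q)) borel of_bool)"
    using assms(1) by (simp add: bernoulli_var_def)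
  also have "\<dots> = (\<integral>b. f (of_bool b) \<partial>measure_pmf (bernoulli_pmf q))"
    using f by (subst integral_distr) auto
  finally show ?thesis using assms(2,3) by simp
qed

text \<open>\<open>bernoulli_var\<close> fixes only the law of the variable, so other values may
  occur on a null set. This is why the bounds used below hold almost everywhere rather than
  pointwise.\<close>

lemma bernoulli_var_AE:
  assumes "bernoulli_var M q X"
  shows "AE \<omega> in M. X \<omega> = 0 \<or> X \<omega> = 1"
proof -
  have "AE y in distr (measure_pmf (bernoulli_pmf q)) borel (of_bool :: bool \<Rightarrow> real). y = 0 \<or> y = 1"
    by (subst AE_distr_iff) auto
  then have "AE y in distr M borel X. y = 0 \<or> y = 1"
    using assms unfolding bernoulli_var_def by metis
  then show ?thesis
    using assms by (intro AE_distrD[of X M borel]) (auto simp: bernoulli_var_def)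
qed

section \<open>Moments and lower tails of sums of independent variables\<close>

context prob_space
begin

lemma integrable_power_bounded:
  fixes X :: "'a \<Rightarrow> real"
  assumes "X \<in> borel_measurable M" "AE \<omega> in M. \<bar>X \<omega>\<bar> \<le> B"
  shows "integrable M (\<lambda>\<omega>. X \<omega> ^ m)"
proof (rule integrable_const_bound)
  show "AE \<omega> in M. norm (X \<omega> ^ m) \<le> B ^ m"
    using assms(2) by eventually_elim (auto simp: power_abs intro: power_mono)
qed (use assms(1) in measurable)

lemma AE_abs_sum_le:
  fixes X :: "'i \<Rightarrow> 'a \<Rightarrow> real"
  assumes "finite I" "\<And>i. i \<in> I \<Longrightarrow> AE \<omega> in M. \<bar>X i \<omega>\<bar> \<le> B i"
  shows "AE \<omega> in M. \<bar>\<Sum>i\<in>I. X i \<omega>\<bar> \<le> (\<Sum>i\<in>I. B i)"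
proof -
  have "AE \<omega> in M. \<forall>i\<in>I. \<bar>X i \<omega>\<bar> \<le> B i"
    using assms by (intro AE_finite_allI) auto
  then show ?thesis
    by eventually_elim (auto intro!: order_trans[OF sum_abs] sum_mono)
qed

text \<open>The fourth moment is wanted because it bounds the variance of a squared row sum. In its
  binomial expansion the terms with exponents 3 and 1 vanish, each containing a factor of mean
  zero.\<close>

lemma moments_sum_centered_indep:
  fixes X :: "'i \<Rightarrow> 'a \<Rightarrow> real"
  assumes "finite I" "indep_vars (\<lambda>_. borel) X I"
    and "\<And>i. i \<in> I \<Longrightarrow> AE \<omega> in M. \<bar>X i \<omega>\<bar> \<le> B i"
    and "\<And>i. i \<in> I \<Longrightarrow> expectation (X i) = 0"
  shows "expectation (\<lambda>\<omega>. \<Sum>i\<in>I. X i \<omega>) = 0"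
    and "expectation (\<lambda>\<omega>. (\<Sum>i\<in>I. X i \<omega>)\<^sup>2) = (\<Sum>i\<in>I. expectation (\<lambda>\<omega>. (X i \<omega>)\<^sup>2))"
    and "expectation (\<lambda>\<omega>. (\<Sum>i\<in>I. X i \<omega>) ^ 4) \<le>
      (\<Sum>i\<in>I. expectation (\<lambda>\<omega>. X i \<omega> ^ 4)) + 3 * (\<Sum>i\<in>I. expectation (\<lambda>\<omega>. (X i \<omega>)\<^sup>2))\<^sup>2"
proof -
  \<comment> \<open>The three claims share one induction, since the fourth moment of the enlarged
    sum involves the first and second moments of the partial sum.\<close>
  have "expectation (\<lambda>\<omega>. \<Sum>i\<in>I. X i \<omega>) = 0 \<and>
    expectation (\<lambda>\<omega>. (\<Sum>i\<in>I. X i \<omega>)\<^sup>2) = (\<Sum>i\<in>I. expectation (\<lambda>\<omega>. (X i \<omega>)\<^sup>2)) \<and>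
    expectation (\<lambda>\<omega>. (\<Sum>i\<in>I. X i \<omega>) ^ 4) \<le>
      (\<Sum>i\<in>I. expectation (\<lambda>\<omega>. X i \<omega> ^ 4)) + 3 * (\<Sum>i\<in>I. expectation (\<lambda>\<omega>. (X i \<omega>)\<^sup>2))\<^sup>2"
    using assms
  proof (induction I rule: finite_induct)
    case empty
    then show ?case by simp
  next
    case (insert i I)
    let ?S = "\<lambda>\<omega>. \<Sum>i\<in>I. X i \<omega>"
    let ?E = "\<lambda>f. \<integral>\<omega>. f \<omega> \<partial>M"
    have "indep_vars (\<lambda>_. borel) X I"
      using insert.prems(1) by (rule indep_vars_subset) auto
    with insert have IH: "?E ?S = 0" "?E (\<lambda>\<omega>. (?S \<omega>)\<^sup>2) = (\<Sum>i\<in>I. ?E (\<lambda>\<omega>. (X i \<omega>)\<^sup>2))"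
      "?E (\<lambda>\<omega>. ?S \<omega> ^ 4) \<le> (\<Sum>i\<in>I. ?E (\<lambda>\<omega>. X i \<omega> ^ 4)) + 3 * (\<Sum>i\<in>I. ?E (\<lambda>\<omega>. (X i \<omega>)\<^sup>2))\<^sup>2"
      by simp_all
    have meas: "X j \<in> borel_measurable M" if "j \<in> insert i I" for j
      using insert.prems(1) that by (auto simp: indep_vars_def)
    then have [measurable]: "?S \<in> borel_measurable M" "X i \<in> borel_measurable M"
      by auto
    have int_X: "integrable M (\<lambda>\<omega>. X i \<omega> ^ m)" for m
      using meas insert.prems(2) by (intro integrable_power_bounded) auto
    have int_S: "integrable M (\<lambda>\<omega>. ?S \<omega> ^ m)" for m
      using AE_abs_sum_le[of I X B] insert by (intro integrable_power_bounded) auto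
    have "indep_var borel (X i) borel ?S"
      using insert by (intro indep_vars_sum) auto
    then have "indep_var borel ((\<lambda>y. y ^ l) \<circ> X i) borel ((\<lambda>y. y ^ m) \<circ> ?S)" for l m
      by (rule indep_var_compose) auto
    then have indep: "indep_var borel (\<lambda>\<omega>. X i \<omega> ^ l) borel (\<lambda>\<omega>. ?S \<omega> ^ m)" for l m
      by (simp add: comp_def)
    have E_mult: "?E (\<lambda>\<omega>. X i \<omega> ^ l * ?S \<omega> ^ m) = ?E (\<lambda>\<omega>. X i \<omega> ^ l) * ?E (\<lambda>\<omega>. ?S \<omega> ^ m)"
      and int_mult: "integrable M (\<lambda>\<omega>. X i \<omega> ^ l * ?S \<omega> ^ m)" for l m
      using indep_var_lebesgue_integral[OF indep int_X int_S]
        indep_var_integrable[OF indep int_X int_S] by auto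
    have X0: "?E (X i) = 0" using insert.prems(3) by simp
    have sum_insert: "(\<Sum>j\<in>insert i I. X j \<omega>) = X i \<omega> + ?S \<omega>" for \<omega>
      using insert.hyps by simp
    have E1: "?E (\<lambda>\<omega>. X i \<omega> + ?S \<omega>) = 0"
      using int_X[of 1] int_S[of 1] X0 IH(1) by simp
    have "?E (\<lambda>\<omega>. (X i \<omega> + ?S \<omega>)\<^sup>2) =
        ?E (\<lambda>\<omega>. (X i \<omega>)\<^sup>2 + 2 * (X i \<omega> ^ 1 * ?S \<omega> ^ 1) + (?S \<omega>)\<^sup>2)"
      by (rule Bochner_Integration.integral_cong) (auto simp: power2_eq_square algebra_simps)
    also have "\<dots> = ?E (\<lambda>\<omega>. (X i \<omega>)\<^sup>2) + 2 * (?E (X i) * ?E ?S) + ?E (\<lambda>\<omega>. (?S \<omega>)\<^sup>2)"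
      using int_X[of 2] int_S[of 2] int_mult[of 1 1] E_mult[of 1 1] by simp
    finally have E2: "?E (\<lambda>\<omega>. (X i \<omega> + ?S \<omega>)\<^sup>2) = ?E (\<lambda>\<omega>. (X i \<omega>)\<^sup>2) + ?E (\<lambda>\<omega>. (?S \<omega>)\<^sup>2)"
      using X0 by simp
    have "?E (\<lambda>\<omega>. (X i \<omega> + ?S \<omega>) ^ 4) =
        ?E (\<lambda>\<omega>. X i \<omega> ^ 4 + 4 * (X i \<omega> ^ 3 * ?S \<omega> ^ 1) + 6 * (X i \<omega> ^ 2 * ?S \<omega> ^ 2)
          + 4 * (X i \<omega> ^ 1 * ?S \<omega> ^ 3) + ?S \<omega> ^ 4)"
      by (rule Bochner_Integration.integral_cong) (auto simp: power4_eq_xxxx power3_eq_cube power2_eq_square algebra_simps)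
    also have "\<dots> = ?E (\<lambda>\<omega>. X i \<omega> ^ 4) + 4 * (?E (\<lambda>\<omega>. X i \<omega> ^ 3) * ?E ?S)
        + 6 * (?E (\<lambda>\<omega>. (X i \<omega>)\<^sup>2) * ?E (\<lambda>\<omega>. (?S \<omega>)\<^sup>2)) + 4 * (?E (X i) * ?E (\<lambda>\<omega>. ?S \<omega> ^ 3))
        + ?E (\<lambda>\<omega>. ?S \<omega> ^ 4)"
      using int_X[of 4] int_S[of 4] int_mult[of 3 1] int_mult[of 2 2] int_mult[of 1 3]
        E_mult[of 3 1] E_mult[of 2 2] E_mult[of 1 3] by simp
    finally have E4: "?E (\<lambda>\<omega>. (X i \<omega> + ?S \<omega>) ^ 4) = ?E (\<lambda>\<omega>. X i \<omega> ^ 4)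
        + 6 * (?E (\<lambda>\<omega>. (X i \<omega>)\<^sup>2) * ?E (\<lambda>\<omega>. (?S \<omega>)\<^sup>2)) + ?E (\<lambda>\<omega>. ?S \<omega> ^ 4)"
      using X0 IH(1) by simp
    \<comment> \<open>The mixed term \<open>6 * (a * s)\<close> is exactly the cross term of
      \<open>3 * (a + s)\<^sup>2\<close>, which explains the constant 3.\<close>
    have "x + 6 * (a * s) + t \<le> x + e + 3 * (a + s)\<^sup>2" if "t \<le> e + 3 * s\<^sup>2" for x a s t e :: real
      using that zero_le_power2[of a] unfolding power2_sum distrib_left by linarith
    from this[OF IH(3)]
    have "?E (\<lambda>\<omega>. (X i \<omega> + ?S \<omega>) ^ 4) \<le> (\<Sum>j\<in>insert i I. ?E (\<lambda>\<omega>. X j \<omega> ^ 4))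
        + 3 * (\<Sum>j\<in>insert i I. ?E (\<lambda>\<omega>. (X j \<omega>)\<^sup>2))\<^sup>2"
      unfolding E4 IH(2) using insert.hyps by simp
    then show ?case
      unfolding sum_insert using E1 E2 IH(2) insert.hyps by simp
  qed
  then show "expectation (\<lambda>\<omega>. \<Sum>i\<in>I. X i \<omega>) = 0"
    and "expectation (\<lambda>\<omega>. (\<Sum>i\<in>I. X i \<omega>)\<^sup>2) = (\<Sum>i\<in>I. expectation (\<lambda>\<omega>. (X i \<omega>)\<^sup>2))"
    and "expectation (\<lambda>\<omega>. (\<Sum>i\<in>I. X i \<omega>) ^ 4) \<le>
      (\<Sum>i\<in>I. expectation (\<lambda>\<omega>. X i \<omega> ^ 4)) + 3 * (\<Sum>i\<in>I. expectation (\<lambda>\<omega>. (X i \<omega>)\<^sup>2))\<^sup>2"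
    by auto
qed

text \<open>Chebyshev's inequality: the sum has mean zero and its variance is the sum of the second
  moments.\<close>

lemma sum_centered_indep_lower_tail:
  fixes X :: "'i \<Rightarrow> 'a \<Rightarrow> real" and v d :: real
  assumes "finite I" "indep_vars (\<lambda>_. borel) X I"
    and "\<And>i. i \<in> I \<Longrightarrow> AE \<omega> in M. \<bar>X i \<omega>\<bar> \<le> B i"
    and "\<And>i. i \<in> I \<Longrightarrow> expectation (X i) = 0"
    and "\<And>i. i \<in> I \<Longrightarrow> expectation (\<lambda>\<omega>. (X i \<omega>)\<^sup>2) \<le> v" and "d > 0"
  shows "prob {\<omega> \<in> space M. (\<Sum>i\<in>I. X i \<omega>) \<le> - d} \<le> card I * v / d\<^sup>2"
proof -
  let ?S = "\<lambda>\<omega>. \<Sum>i\<in>I. X i \<omega>"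
  have [measurable]: "X i \<in> borel_measurable M" if "i \<in> I" for i
    using assms(2) that by (auto simp: indep_vars_def)
  have S [measurable]: "?S \<in> borel_measurable M"
    by measurable
  have int: "integrable M (\<lambda>\<omega>. (?S \<omega>)\<^sup>2)"
    using AE_abs_sum_le[of I X B] assms by (intro integrable_power_bounded) auto
  note mom = moments_sum_centered_indep[OF assms(1-4)]
  have "prob {\<omega> \<in> space M. ?S \<omega> \<le> - d} \<le> prob {\<omega> \<in> space M. \<bar>?S \<omega> - expectation ?S\<bar> \<ge> d}"
    using mom(1) by (intro finite_measure_mono) auto
  also have "\<dots> \<le> variance ?S / d\<^sup>2"
    by (rule Chebyshev_inequality[OF S int \<open>d > 0\<close>])
  also have "\<dots> = (\<Sum>i\<in>I. expectation (\<lambda>\<omega>. (X i \<omega>)\<^sup>2)) / d\<^sup>2"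
    by (simp add: mom)
  also have "\<dots> \<le> card I * v / d\<^sup>2"
    using assms(5) by (intro divide_right_mono sum_bounded_above) auto
  finally show ?thesis .
qed

text \<open>Injectivity makes the singleton blocks \<open>{f j}\<close> disjoint, and variables
  built from disjoint blocks are independent. It transfers independence from the tensor to a slice
  and from a slice to one row.\<close>

lemma indep_vars_comp_inj:
  assumes "indep_vars (\<lambda>_. N) X I" "inj_on f J" "f ` J \<subseteq> I"
  shows "indep_vars (\<lambda>_. N) (\<lambda>j. X (f j)) J"
proof -
  have "indep_vars (\<lambda>j. PiM {f j} (\<lambda>_. N)) (\<lambda>j \<omega>. restrict (\<lambda>i. X i \<omega>) {f j}) J"
    using assms(2,3) by (intro indep_vars_restrict[OF assms(1)])
      (auto simp: disjoint_family_on_def inj_on_def)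
  then have "indep_vars (\<lambda>_. N) (\<lambda>j \<omega>. restrict (\<lambda>i. X i \<omega>) {f j} (f j)) J"
    by (rule indep_vars_compose2[where Y = "\<lambda>j g. g (f j)"]) measurable
  then show ?thesis by simp
qed

text \<open>What matters is the factor \<open>p\<close> in the linear term of the fourth moment
  bound. Without it the error for the remaining rows would be of order n / (n p)^3, which need not
  vanish.\<close>

lemma bernoulli_centered_sum_moments:
  fixes X :: "'i \<Rightarrow> 'a \<Rightarrow> real" and p :: real
  assumes "finite s" "indep_vars (\<lambda>_. borel) X s"
    and bern: "\<And>i. i \<in> s \<Longrightarrow> bernoulli_var M p (X i)" and p: "0 \<le> p" "p \<le> 1"
  shows "AE \<omega> in M. \<bar>\<Sum>i\<in>s. (X i \<omega> - p)\<bar> \<le> card s"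
    and "expectation (\<lambda>\<omega>. (\<Sum>i\<in>s. (X i \<omega> - p))\<^sup>2) = card s * (p * (1 - p))"
    and "expectation (\<lambda>\<omega>. (\<Sum>i\<in>s. (X i \<omega> - p)) ^ 4) \<le> card s * p + 3 * (card s * p)\<^sup>2"
proof -
  have E: "expectation (\<lambda>\<omega>. f (X i \<omega>)) = p * f 1 + (1 - p) * f 0"
    if "i \<in> s" "f \<in> borel_measurable borel" for i f
    using bernoulli_var_integral[OF bern p] that by blast
  have bd: "AE \<omega> in M. \<bar>X i \<omega> - p\<bar> \<le> 1" if "i \<in> s" for i
    using bernoulli_var_AE[OF bern[OF that]] by eventually_elim (use p in auto)
  have "indep_vars (\<lambda>_. borel) (\<lambda>i \<omega>. X i \<omega> - p) s"
    by (rule indep_vars_compose2[OF assms(2)]) auto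
  moreover have "expectation (\<lambda>\<omega>. X i \<omega> - p) = 0" if "i \<in> s" for i
    using E[OF that, of "\<lambda>x. x - p"] by (simp add: algebra_simps)
  ultimately have mom:
    "expectation (\<lambda>\<omega>. (\<Sum>i\<in>s. (X i \<omega> - p))\<^sup>2) = (\<Sum>i\<in>s. expectation (\<lambda>\<omega>. (X i \<omega> - p)\<^sup>2))"
    "expectation (\<lambda>\<omega>. (\<Sum>i\<in>s. (X i \<omega> - p)) ^ 4) \<le>
      (\<Sum>i\<in>s. expectation (\<lambda>\<omega>. (X i \<omega> - p) ^ 4)) + 3 * (\<Sum>i\<in>s. expectation (\<lambda>\<omega>. (X i \<omega> - p)\<^sup>2))\<^sup>2"
    using moments_sum_centered_indep[of s "\<lambda>i \<omega>. X i \<omega> - p" "\<lambda>_. 1"] bd assms(1) by auto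
  have E2: "expectation (\<lambda>\<omega>. (X i \<omega> - p)\<^sup>2) = p * (1 - p)" if "i \<in> s" for i
    using E[OF that, of "\<lambda>x. (x - p)\<^sup>2"] by (simp add: power2_eq_square algebra_simps)
  have E4: "expectation (\<lambda>\<omega>. (X i \<omega> - p) ^ 4) \<le> p" if "i \<in> s" for i
  proof -
    have "expectation (\<lambda>\<omega>. (X i \<omega> - p) ^ 4) = p * (1 - p) * ((1 - p) ^ 3 + p ^ 3)"
      using E[OF that, of "\<lambda>x. (x - p) ^ 4"]
      by (simp add: power4_eq_xxxx power3_eq_cube algebra_simps)
    \<comment> \<open>On the unit interval a cube is at most its base.\<close>
    also have "\<dots> \<le> p * (1 - p) * ((1 - p) + p)"
      using p power_decreasing[of 1 3 p] power_decreasing[of 1 3 "1 - p"]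
      by (intro mult_left_mono add_mono) auto
    also have "\<dots> \<le> p" using p by (simp add: mult_left_le)
    finally show ?thesis .
  qed
  show "AE \<omega> in M. \<bar>\<Sum>i\<in>s. (X i \<omega> - p)\<bar> \<le> card s"
    using AE_abs_sum_le[of s "\<lambda>i \<omega>. X i \<omega> - p" "\<lambda>_. 1"] bd assms(1) by simp
  show "expectation (\<lambda>\<omega>. (\<Sum>i\<in>s. (X i \<omega> - p))\<^sup>2) = card s * (p * (1 - p))"
    using mom(1) E2 by simp
  have "(card s * (p * (1 - p)))\<^sup>2 \<le> (card s * p)\<^sup>2"
    using p by (intro power_mono mult_left_mono) (auto simp: mult_left_le)
  moreover have "(\<Sum>i\<in>s. expectation (\<lambda>\<omega>. (X i \<omega> - p) ^ 4)) \<le> card s * p"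
    using E4 by (intro sum_bounded_above) auto
  ultimately show "expectation (\<lambda>\<omega>. (\<Sum>i\<in>s. (X i \<omega> - p)) ^ 4) \<le> card s * p + 3 * (card s * p)\<^sup>2"
    using mom(2) E2 by simp
qed

text \<open>The squared row sums are independent across rows with common mean \<open>c\<close>, and
  the variance of each is at most the fourth moment of its row sum. Chebyshev's inequality then
  applies to their total.\<close>

lemma bernoulli_quadratic_lower_tail:
  fixes X :: "'i \<times> 'j \<Rightarrow> 'a \<Rightarrow> real" and p d :: real
  assumes fin: "finite R" "finite s" and indep: "indep_vars (\<lambda>_. borel) X (R \<times> s)"
    and bern: "\<And>i. i \<in> R \<times> s \<Longrightarrow> bernoulli_var M p (X i)" and p: "0 \<le> p" "p \<le> 1" and "d > 0"
  shows "prob {\<omega> \<in> space M. (\<Sum>a\<in>R. (\<Sum>b\<in>s. (X (a, b) \<omega> - p))\<^sup>2) \<le> card R * (card s * (p * (1 - p))) - d}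
    \<le> card R * (card s * p + 3 * (card s * p)\<^sup>2) / d\<^sup>2"
proof -
  define W where "W = (\<lambda>a \<omega>. \<Sum>b\<in>s. (X (a, b) \<omega> - p))"
  define c where "c = card s * (p * (1 - p))"
  have c: "0 \<le> c" using p by (simp add: c_def)
  have [measurable]: "X (a, b) \<in> borel_measurable M" if "a \<in> R" "b \<in> s" for a b
    using indep that by (auto simp: indep_vars_def)
  have Wm [measurable]: "W a \<in> borel_measurable M" if "a \<in> R" for a
    unfolding W_def using that by measurable
  have W_mom: "AE \<omega> in M. \<bar>W a \<omega>\<bar> \<le> card s" "expectation (\<lambda>\<omega>. (W a \<omega>)\<^sup>2) = c"
    "expectation (\<lambda>\<omega>. W a \<omega> ^ 4) \<le> card s * p + 3 * (card s * p)\<^sup>2" if "a \<in> R" for a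
  proof -
    have "indep_vars (\<lambda>_. borel) (\<lambda>b. X (a, b)) s"
      using that by (intro indep_vars_comp_inj[OF indep]) (auto simp: inj_on_def)
    from bernoulli_centered_sum_moments[OF fin(2) this _ p] bern that
    show "AE \<omega> in M. \<bar>W a \<omega>\<bar> \<le> card s" "expectation (\<lambda>\<omega>. (W a \<omega>)\<^sup>2) = c"
      "expectation (\<lambda>\<omega>. W a \<omega> ^ 4) \<le> card s * p + 3 * (card s * p)\<^sup>2"
      by (auto simp: W_def c_def)
  qed
  have int: "integrable M (\<lambda>\<omega>. W a \<omega> ^ m)" if "a \<in> R" for a m
    using Wm[OF that] W_mom(1)[OF that] by (rule integrable_power_bounded)
  \<comment> \<open>Distinct rows occupy disjoint blocks of the index set, so functions of single
    rows are independent.\<close>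
  have "indep_vars (\<lambda>a. PiM ({a} \<times> s) (\<lambda>_. borel)) (\<lambda>a \<omega>. restrict (\<lambda>i. X i \<omega>) ({a} \<times> s)) R"
    by (rule indep_vars_restrict[OF indep]) (auto simp: disjoint_family_on_def)
  then have "indep_vars (\<lambda>_. borel)
      (\<lambda>a \<omega>. (\<Sum>b\<in>s. (restrict (\<lambda>i. X i \<omega>) ({a} \<times> s) (a, b) - p))\<^sup>2 - c) R"
    by (rule indep_vars_compose2[where Y = "\<lambda>a g. (\<Sum>b\<in>s. (g (a, b) - p))\<^sup>2 - c"]) measurable
  then have ind: "indep_vars (\<lambda>_. borel) (\<lambda>a \<omega>. (W a \<omega>)\<^sup>2 - c) R"
    by (simp add: W_def)
  have bd: "AE \<omega> in M. \<bar>(W a \<omega>)\<^sup>2 - c\<bar> \<le> (card s)\<^sup>2 + c" if "a \<in> R" for a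
    using W_mom(1)[OF that]
  proof eventually_elim
    case (elim \<omega>)
    then have "(W a \<omega>)\<^sup>2 \<le> (card s)\<^sup>2"
      using power_mono[OF elim, of 2] by simp
    then show ?case unfolding abs_le_iff using c zero_le_power2[of "W a \<omega>"] by linarith
  qed
  have mean: "expectation (\<lambda>\<omega>. (W a \<omega>)\<^sup>2 - c) = 0" if "a \<in> R" for a
    using int[OF that, of 2] W_mom(2)[OF that] by (simp add: prob_space)
  have var: "expectation (\<lambda>\<omega>. ((W a \<omega>)\<^sup>2 - c)\<^sup>2) \<le> card s * p + 3 * (card s * p)\<^sup>2" if "a \<in> R" for a
  proof -
    have "expectation (\<lambda>\<omega>. ((W a \<omega>)\<^sup>2 - c)\<^sup>2) = expectation (\<lambda>\<omega>. W a \<omega> ^ 4 - 2 * c * (W a \<omega>)\<^sup>2 + c\<^sup>2)"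
      by (rule Bochner_Integration.integral_cong) (auto simp: power4_eq_xxxx power2_eq_square algebra_simps)
    also have "\<dots> = expectation (\<lambda>\<omega>. W a \<omega> ^ 4) - c\<^sup>2"
      using int[OF that, of 2] int[OF that, of 4] W_mom(2)[OF that]
      by (simp add: prob_space power2_eq_square)
    finally show ?thesis using W_mom(3)[OF that] zero_le_power2[of c] by linarith
  qed
  have "prob {\<omega> \<in> space M. (\<Sum>a\<in>R. ((W a \<omega>)\<^sup>2 - c)) \<le> - d} \<le> card R * (card s * p + 3 * (card s * p)\<^sup>2) / d\<^sup>2"
    by (rule sum_centered_indep_lower_tail[OF fin(1) ind bd mean var \<open>d > 0\<close>])
  then show ?thesis
    unfolding sum_subtractf W_def c_def by (simp add: algebra_simps)
qed

lemma bernoulli_count_lower_tail: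
  fixes X :: "'j \<Rightarrow> 'a \<Rightarrow> real" and p d :: real
  assumes fin: "finite C" and indep: "indep_vars (\<lambda>_. borel) X C"
    and bern: "\<And>i. i \<in> C \<Longrightarrow> bernoulli_var M p (X i)" and p: "0 \<le> p" "p \<le> 1" and "d > 0"
  shows "prob {\<omega> \<in> space M. card {b\<in>C. X b \<omega> = 1} \<le> card C * p - d} \<le> card C * p / d\<^sup>2"
proof -
  \<comment> \<open>The indicator of the value 1 replaces \<open>X b\<close> itself, so that the sum
    is the centered cardinality at every point and not only almost surely.\<close>
  define Y where "Y = (\<lambda>b \<omega>. of_bool (X b \<omega> = 1) - p)"
  have f: "(\<lambda>x::real. of_bool (x = 1) - p) \<in> borel_measurable borel"
    "(\<lambda>x::real. (of_bool (x = 1) - p)\<^sup>2) \<in> borel_measurable borel" by measurable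
  have "indep_vars (\<lambda>_. borel) Y C"
    unfolding Y_def by (rule indep_vars_compose2[OF indep f(1)])
  moreover have "AE \<omega> in M. \<bar>Y b \<omega>\<bar> \<le> 1" for b
    using p by (auto simp: Y_def)
  moreover have "expectation (Y b) = 0" if "b \<in> C" for b
    using bernoulli_var_integral[OF bern[OF that] p f(1)] by (simp add: Y_def algebra_simps)
  moreover have "expectation (\<lambda>\<omega>. (Y b \<omega>)\<^sup>2) \<le> p" if "b \<in> C" for b
  proof -
    have "expectation (\<lambda>\<omega>. (Y b \<omega>)\<^sup>2) = p * (1 - p)\<^sup>2 + (1 - p) * p\<^sup>2"
      using bernoulli_var_integral[OF bern[OF that] p f(2)] by (simp add: Y_def)
    also have "\<dots> = p - p\<^sup>2" by (simp add: power2_eq_square algebra_simps)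
    finally show ?thesis by simp
  qed
  ultimately have "prob {\<omega> \<in> space M. (\<Sum>b\<in>C. Y b \<omega>) \<le> - d} \<le> card C * p / d\<^sup>2"
    using \<open>d > 0\<close> fin by (intro sum_centered_indep_lower_tail[where B = "\<lambda>_. 1"]) auto
  moreover have "(\<Sum>b\<in>C. Y b \<omega>) = card {b\<in>C. X b \<omega> = 1} - card C * p" for \<omega>
    using fin by (simp add: Y_def sum_subtractf sum_of_bool_eq Int_def)
  ultimately show ?thesis by (simp add: algebra_simps)
qed

text \<open>Conditioning on the value of \<open>S\<close> without conditional probabilities: the
  events \<open>S \<omega> = s\<close> are disjoint, so their probabilities weight the uniform bound
  \<open>\<delta>\<close> with total weight at most 1. It is meant for \<open>S\<close> the support
  of the first row and \<open>B s\<close> an event about the other rows.\<close>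

lemma prob_random_set_le:
  assumes "finite F"
    and S: "\<And>s. s \<in> F \<Longrightarrow> {\<omega> \<in> space M. S \<omega> = s} \<in> events"
    and B: "\<And>s. s \<in> F \<Longrightarrow> {\<omega> \<in> space M. B s \<omega>} \<in> events"
    and indep: "\<And>s. s \<in> F \<Longrightarrow> prob {\<omega> \<in> space M. S \<omega> = s \<and> B s \<omega>} =
      prob {\<omega> \<in> space M. S \<omega> = s} * prob {\<omega> \<in> space M. B s \<omega>}"
    and le: "\<And>s. s \<in> F \<Longrightarrow> prob {\<omega> \<in> space M. B s \<omega>} \<le> \<delta>" and "\<delta> \<ge> 0"
  shows "{\<omega> \<in> space M. S \<omega> \<in> F \<and> B (S \<omega>) \<omega>} \<in> events"
    and "prob {\<omega> \<in> space M. S \<omega> \<in> F \<and> B (S \<omega>) \<omega>} \<le> \<delta>"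
proof -
  have eq: "{\<omega> \<in> space M. S \<omega> \<in> F \<and> B (S \<omega>) \<omega>} = (\<Union>s\<in>F. {\<omega> \<in> space M. S \<omega> = s \<and> B s \<omega>})"
    by auto
  have "{\<omega> \<in> space M. S \<omega> = s \<and> B s \<omega>} \<in> events" if "s \<in> F" for s
    using sets.Int[OF S[OF that] B[OF that]] by (simp add: Int_def conj_ac cong: conj_cong)
  then have ev: "(\<lambda>s. {\<omega> \<in> space M. S \<omega> = s \<and> B s \<omega>}) ` F \<subseteq> events"
    by blast
  then show "{\<omega> \<in> space M. S \<omega> \<in> F \<and> B (S \<omega>) \<omega>} \<in> events"
    unfolding eq using assms(1) by (intro sets.finite_UN) auto
  have "prob {\<omega> \<in> space M. S \<omega> \<in> F \<and> B (S \<omega>) \<omega>} \<le> (\<Sum>s\<in>F. prob {\<omega> \<in> space M. S \<omega> = s \<and> B s \<omega>})"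
    unfolding eq using assms(1) ev by (intro finite_measure_subadditive_finite) auto
  also have "\<dots> \<le> (\<Sum>s\<in>F. prob {\<omega> \<in> space M. S \<omega> = s} * \<delta>)"
    using indep le by (intro sum_mono) (auto intro: mult_left_mono)
  also have "\<dots> = prob (\<Union>s\<in>F. {\<omega> \<in> space M. S \<omega> = s}) * \<delta>"
    using assms(1) S by (subst finite_measure_finite_Union)
      (auto simp: disjoint_family_on_def sum_distrib_right)
  also have "\<dots> \<le> \<delta>"
    using \<open>\<delta> \<ge> 0\<close> by (simp add: mult_left_le_one_le)
  finally show "prob {\<omega> \<in> space M. S \<omega> \<in> F \<and> B (S \<omega>) \<omega>} \<le> \<delta>" .
qed

end

section \<open>The lower bound for the spectral norm\<close>

text \<open>The first row is constantly \<open>r\<close> on \<open>S\<close>, so against the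
  normalised indicator of \<open>S\<close> it yields sqrt(\<open>card S\<close>) times
  \<open>r\<close>, with square \<open>card S * r\<^sup>2\<close>. In the application
  \<open>r\<close> is \<open>1 - p\<close>.\<close>

lemma spectral_norm_ge_support:
  fixes r :: real
  assumes "k \<ge> 2" "n \<ge> 1" and S: "S \<subseteq> {1..n}" "S \<noteq> {}"
    and row: "\<And>b. b \<in> S \<Longrightarrow> t (slice_index k 1 b) = r"
  shows "sqrt (card S * r\<^sup>2 + (\<Sum>a=2..n. (\<Sum>b\<in>S. t (slice_index k a b))\<^sup>2) / card S)
    \<le> spectral_norm k n t"
proof -
  have fin: "finite S" using S(1) finite_subset by blast
  define c where "c = real (card S)"
  have c: "c > 0" using S(2) fin by (simp add: c_def card_gt_0_iff)
  define x where "x = (\<lambda>b. of_bool (b \<in> S) / sqrt c)"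
  have restrict: "(\<Sum>b=1..n. f b * x b) = (\<Sum>b\<in>S. f b) / sqrt c" for f :: "nat \<Rightarrow> real"
  proof -
    have "(\<Sum>b=1..n. f b * x b) = (\<Sum>b\<in>S. f b * x b)"
      using S(1) by (intro sum.mono_neutral_right) (auto simp: x_def)
    then show ?thesis by (simp add: x_def sum_divide_distrib)
  qed
  have "(\<Sum>b=1..n. (x b)\<^sup>2) = (\<Sum>b\<in>S. x b) / sqrt c"
    using restrict[of x] by (simp add: power2_eq_square)
  also have "(\<Sum>b\<in>S. x b) = c / sqrt c"
    by (simp add: x_def c_def)
  finally have "(\<Sum>b=1..n. (x b)\<^sup>2) = 1"
    using c by simp
  then have "L2_set x {1..n} = 1"
    by (simp add: L2_set_def)
  from spectral_norm_ge_slice[OF assms(1,2) this, of t]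
  have "sqrt (\<Sum>a=1..n. ((\<Sum>b\<in>S. t (slice_index k a b)) / sqrt c)\<^sup>2) \<le> spectral_norm k n t"
    unfolding restrict by (simp add: L2_set_def)
  also have "(\<Sum>a=1..n. ((\<Sum>b\<in>S. t (slice_index k a b)) / sqrt c)\<^sup>2) =
      (\<Sum>a=1..n. (\<Sum>b\<in>S. t (slice_index k a b))\<^sup>2) / c"
    using c by (simp add: power_divide flip: sum_divide_distrib)
  also have "(\<Sum>a=1..n. (\<Sum>b\<in>S. t (slice_index k a b))\<^sup>2) =
      (c * r)\<^sup>2 + (\<Sum>a=2..n. (\<Sum>b\<in>S. t (slice_index k a b))\<^sup>2)"
    using sum.atLeast_Suc_atMost[OF assms(2), of "\<lambda>a. (\<Sum>b\<in>S. t (slice_index k a b))\<^sup>2"] row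
    by (simp add: c_def numeral_2_eq_2)
  finally show ?thesis
    using c unfolding c_def[symmetric] by (simp add: add_divide_distrib power2_eq_square mult_ac)
qed

text \<open>The first error term bounds the probability that the support of the first row has at
  most 3/4 of its mean size n p; the bracket bounds the probability that, for a larger support, the
  other rows contribute at most n p / 2. Otherwise the squared norm is at least (3/4) (9/10)^2 n p +
  n p / 2, which exceeds n p.\<close>

lemma (in prob_space) spectral_norm_lower_bound_prob:
  fixes X :: "(nat \<Rightarrow> nat) \<Rightarrow> 'a \<Rightarrow> real" and p :: real
  assumes "k \<ge> 2" "n \<ge> 10"
    and indep: "indep_vars (\<lambda>_. borel) X (multi_indices k n)"
    and bern: "\<And>i. i \<in> multi_indices k n \<Longrightarrow> bernoulli_var M p (X i)"
    and p: "0 < p" "p \<le> 1 / 10"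
  shows "1 - (16 / (n * p) + (64 / (3 * (n * p)\<^sup>2) + 48 / n))
    \<le> prob {\<omega> \<in> space M. spectral_norm k n (\<lambda>i. X i \<omega> - p) \<ge> sqrt (n * p)}"
proof -
  define Y where "Y = (\<lambda>ab. X (case ab of (a, b) \<Rightarrow> slice_index k a b))"
  define S where "S = (\<lambda>\<omega>. {b\<in>{1..n}. Y (1, b) \<omega> = 1})"
  define F where "F = {s. s \<subseteq> {1..n} \<and> 3 / 4 * (n * p) < card s}"
  define Q where "Q = (\<lambda>s \<omega>. \<Sum>a=2..n. (\<Sum>b\<in>s. (Y (a, b) \<omega> - p))\<^sup>2)"
  define \<delta> where "\<delta> = 64 / (3 * (n * p)\<^sup>2) + 48 / n"
  have n: "n \<ge> 1" "real n \<ge> 10" using assms(2) by auto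
  have np: "n * p > 0" using n p by simp
  have "finite F" unfolding F_def by (rule finite_subset[of _ "Pow {1..n}"]) auto
  have indep_Y: "indep_vars (\<lambda>_. borel) Y ({1..n} \<times> {1..n})"
    unfolding Y_def using slice_index_mem
    by (intro indep_vars_comp_inj[OF indep] inj_slice_index[OF assms(1)]) auto
  have bern_Y: "bernoulli_var M p (Y i)" if "i \<in> {1..n} \<times> {1..n}" for i
    using that bern slice_index_mem by (auto simp: Y_def)
  have Ym [measurable]: "Y (a, b) \<in> borel_measurable M" if "a \<in> {1..n}" "b \<in> {1..n}" for a b
    using bern_Y that by (auto simp: bernoulli_var_def)
  have Q_meas [measurable]: "Q s \<in> borel_measurable M" if "s \<in> F" for s
  proof -
    have "Y (a, b) \<in> borel_measurable M" if "a \<in> {2..n}" "b \<in> s" for a b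
      using that \<open>s \<in> F\<close> by (intro Ym) (auto simp: F_def)
    then show ?thesis unfolding Q_def by measurable
  qed
  have S_eq: "S \<omega> = s \<longleftrightarrow> (\<forall>b\<in>{1..n}. (Y (1, b) \<omega> = 1) = (b \<in> s))" if "s \<in> F" for s \<omega>
    using that by (auto simp: S_def F_def)
  have S_meas: "{\<omega> \<in> space M. S \<omega> = s} \<in> events" if "s \<in> F" for s
  proof -
    have "Y (1, b) \<in> borel_measurable M" if "b \<in> {1..n}" for b
      using that n by (intro Ym) auto
    then have "{\<omega> \<in> space M. \<forall>b\<in>{1..n}. (Y (1, b) \<omega> = 1) = (b \<in> s)} \<in> events" by measurable
    then show ?thesis by (simp add: S_eq[OF that])
  qed
  have Q_ev: "{\<omega> \<in> space M. Q s \<omega> \<le> card s * (n * p / 2)} \<in> events" if "s \<in> F" for s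
    using Q_meas[OF that] by measurable
  have ind: "prob {\<omega> \<in> space M. S \<omega> = s \<and> Q s \<omega> \<le> card s * (n * p / 2)} =
      prob {\<omega> \<in> space M. S \<omega> = s} * prob {\<omega> \<in> space M. Q s \<omega> \<le> card s * (n * p / 2)}"
    if "s \<in> F" for s
  proof -
    have s: "s \<subseteq> {1..n}" using that by (simp add: F_def)
    \<comment> \<open>The event about \<open>S\<close> reads only the first row and
      \<open>Q s\<close> only the later ones, so the two are functions of disjoint blocks.\<close>
    let ?A = "{1 :: nat} \<times> {1..n}" and ?B = "{2..n} \<times> s"
    define U where "U = {g \<in> space (PiM ?A (\<lambda>_. borel)). \<forall>b\<in>{1..n}. (g (1, b) = (1::real)) = (b \<in> s)}"
    define V where "V = {g \<in> space (PiM ?B (\<lambda>_. borel)).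
      (\<Sum>a=2..n. (\<Sum>b\<in>s. (g (a, b) - p))\<^sup>2) \<le> card s * (n * p / 2)}"
    have "indep_var (PiM ?A (\<lambda>_. borel)) (\<lambda>\<omega>. restrict (\<lambda>i. Y i \<omega>) ?A)
        (PiM ?B (\<lambda>_. borel)) (\<lambda>\<omega>. restrict (\<lambda>i. Y i \<omega>) ?B)"
      using n s by (intro indep_var_restrict[OF indep_Y]) auto
    moreover have "U \<in> sets (PiM ?A (\<lambda>_. borel))" "V \<in> sets (PiM ?B (\<lambda>_. borel))"
      unfolding U_def V_def by measurable
    ultimately have "prob ((\<lambda>\<omega>. (restrict (\<lambda>i. Y i \<omega>) ?A, restrict (\<lambda>i. Y i \<omega>) ?B)) -` (U \<times> V) \<inter> space M) =
        prob ((\<lambda>\<omega>. restrict (\<lambda>i. Y i \<omega>) ?A) -` U \<inter> space M) *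
        prob ((\<lambda>\<omega>. restrict (\<lambda>i. Y i \<omega>) ?B) -` V \<inter> space M)"
      by (rule indep_varD)
    moreover have "(\<lambda>\<omega>. restrict (\<lambda>i. Y i \<omega>) ?A) -` U \<inter> space M = {\<omega> \<in> space M. S \<omega> = s}"
      by (auto simp: U_def S_eq[OF that] space_PiM)
    moreover have "(\<lambda>\<omega>. restrict (\<lambda>i. Y i \<omega>) ?B) -` V \<inter> space M =
        {\<omega> \<in> space M. Q s \<omega> \<le> card s * (n * p / 2)}"
      by (auto simp: V_def Q_def space_PiM)
    moreover have "(\<lambda>\<omega>. (restrict (\<lambda>i. Y i \<omega>) ?A, restrict (\<lambda>i. Y i \<omega>) ?B)) -` (U \<times> V) \<inter> space M =
        {\<omega> \<in> space M. S \<omega> = s \<and> Q s \<omega> \<le> card s * (n * p / 2)}"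
      by (auto simp: U_def S_eq[OF that] V_def Q_def space_PiM)
    ultimately show ?thesis by simp
  qed
  have tail: "prob {\<omega> \<in> space M. Q s \<omega> \<le> card s * (n * p / 2)} \<le> \<delta>" if "s \<in> F" for s
  proof -
    define c where "c = real (card s)"
    have s: "s \<subseteq> {1..n}" and c: "3 / 4 * (n * p) < c"
      using that by (auto simp: F_def c_def)
    have "c > 0" using c np by linarith
    \<comment> \<open>By \<open>n \<ge> 10\<close> and \<open>p \<le> 1 / 10\<close> the mean of
      \<open>Q s\<close> is at least 0.81 c n p, hence at least (3/4) c n p. A drop to half of c n p
      is therefore a deviation of at least a quarter.\<close>
    define d where "d = c * (n * p / 4)"
    have d: "d > 0" using \<open>c > 0\<close> np by (simp add: d_def)
    have card: "real (card {2..n}) = real n - 1"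
      using n by (simp add: of_nat_diff)
    have "(9 / 10 * n) * (9 / 10) \<le> (real n - 1) * (1 - p)"
      using n p by (intro mult_mono) auto
    then have "3 / 4 * n * (c * p) \<le> (real n - 1) * (1 - p) * (c * p)"
      using \<open>c > 0\<close> p by (intro mult_right_mono) auto
    then have "c * (n * p / 2) \<le> card {2..n} * (card s * (p * (1 - p))) - d"
      unfolding card c_def[symmetric] d_def by (simp add: algebra_simps)
    then have "{\<omega> \<in> space M. Q s \<omega> \<le> c * (n * p / 2)} \<subseteq>
      {\<omega> \<in> space M. Q s \<omega> \<le> card {2..n} * (card s * (p * (1 - p))) - d}" by auto
    moreover have "{\<omega> \<in> space M. Q s \<omega> \<le> card {2..n} * (card s * (p * (1 - p))) - d} \<in> events"
      using Q_meas[OF that] by measurable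
    ultimately have "prob {\<omega> \<in> space M. Q s \<omega> \<le> c * (n * p / 2)} \<le>
      prob {\<omega> \<in> space M. Q s \<omega> \<le> card {2..n} * (card s * (p * (1 - p))) - d}"
      by (rule finite_measure_mono)
    also have "\<dots> \<le> card {2..n} * (card s * p + 3 * (card s * p)\<^sup>2) / d\<^sup>2"
      unfolding Q_def
    proof (rule bernoulli_quadratic_lower_tail)
      show "indep_vars (\<lambda>_. borel) Y ({2..n} \<times> s)"
        using s by (intro indep_vars_subset[OF indep_Y]) auto
      show "bernoulli_var M p (Y i)" if "i \<in> {2..n} \<times> s" for i
        using that s by (intro bern_Y) auto
      show "finite s" using s finite_subset by blast
    qed (use p d in auto)
    also have "\<dots> \<le> n * (c * p + 3 * (c * p)\<^sup>2) / d\<^sup>2"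
      unfolding card c_def[symmetric] using p \<open>c > 0\<close>
      by (intro divide_right_mono mult_right_mono) auto
    also have "\<dots> = 16 / (n * p) * (1 / c) + 48 / n"
      using \<open>c > 0\<close> p n by (simp add: d_def field_simps power2_eq_square)
    \<comment> \<open>The lower bound on \<open>c\<close> that defines \<open>F\<close> removes the
      dependence on \<open>s\<close>.\<close>
    also have "\<dots> \<le> 16 / (n * p) * (1 / (3 / 4 * (n * p))) + 48 / n"
      using np c by (intro add_right_mono mult_left_mono divide_left_mono) auto
    also have "\<dots> = \<delta>"
      by (simp add: \<delta>_def power2_eq_square)
    finally show ?thesis by (simp add: c_def)
  qed
  have "\<delta> \<ge> 0" by (simp add: \<delta>_def)
  note bad = prob_random_set_le[of F S "\<lambda>s \<omega>. Q s \<omega> \<le> card s * (n * p / 2)" \<delta>,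
      OF \<open>finite F\<close> S_meas Q_ev ind tail \<open>\<delta> \<ge> 0\<close>]
  let ?B1 = "{\<omega> \<in> space M. card (S \<omega>) \<le> 3 / 4 * (n * p)}"
  let ?B2 = "{\<omega> \<in> space M. S \<omega> \<in> F \<and> Q (S \<omega>) \<omega> \<le> card (S \<omega>) * (n * p / 2)}"
  let ?G = "{\<omega> \<in> space M. spectral_norm k n (\<lambda>i. X i \<omega> - p) \<ge> sqrt (n * p)}"
  \<comment> \<open>The deviation n p / 4 corresponds to the threshold 3/4 n p and gives the bound
    16 / (n p).\<close>
  have "prob {\<omega> \<in> space M. card (S \<omega>) \<le> card {1..n} * p - n * p / 4} \<le> card {1..n} * p / (n * p / 4)\<^sup>2"
    unfolding S_def
  proof (rule bernoulli_count_lower_tail)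
    show "indep_vars (\<lambda>_. borel) (\<lambda>b. Y (1, b)) {1..n}"
      using n by (intro indep_vars_comp_inj[OF indep_Y]) (auto simp: inj_on_def)
    show "bernoulli_var M p (Y (1, b))" if "b \<in> {1..n}" for b
      using that n by (intro bern_Y) auto
  qed (use p np in auto)
  then have B1: "prob ?B1 \<le> 16 / (n * p)"
    using n p by (simp add: power2_eq_square mult.commute)
  have "{\<omega> \<in> space M. S \<omega> \<in> F} \<in> events"
  proof -
    have "{\<omega> \<in> space M. S \<omega> \<in> F} = (\<Union>s\<in>F. {\<omega> \<in> space M. S \<omega> = s})" by auto
    then show ?thesis using \<open>finite F\<close> S_meas by auto
  qed
  \<comment> \<open>\<open>S \<omega>\<close> always lies in \<open>{1..n}\<close>, so it leaves
    \<open>F\<close> only by being too small. Measurability of \<open>?B1\<close> thus reduces to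
    that of finitely many events.\<close>
  moreover have "?B1 = space M - {\<omega> \<in> space M. S \<omega> \<in> F}"
    by (auto simp: F_def S_def)
  ultimately have B1_ev: "?B1 \<in> events" by simp
  have "X i \<in> borel_measurable M" if "i \<in> multi_indices k n" for i
    using bern[OF that] by (simp add: bernoulli_var_def)
  then have "(\<lambda>\<omega>. spectral_norm k n (\<lambda>i. X i \<omega> - p)) \<in> borel_measurable M"
    using n by (intro spectral_norm_measurable) auto
  then have G_ev: "?G \<in> events" by measurable
  \<comment> \<open>Avoiding \<open>?B1\<close> puts \<open>S \<omega>\<close> into
    \<open>F\<close>, and only then does avoiding \<open>?B2\<close> say that
    \<open>Q (S \<omega>) \<omega>\<close> is large.\<close>
  have "\<omega> \<in> ?G" if \<omega>: "\<omega> \<in> space M" "\<omega> \<notin> ?B1" "\<omega> \<notin> ?B2" for \<omega>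
  proof -
    define c where "c = real (card (S \<omega>))"
    have sub: "S \<omega> \<subseteq> {1..n}" by (auto simp: S_def)
    have c: "3 / 4 * (n * p) < c" using \<omega> by (simp add: c_def)
    then have "c > 0" using np by linarith
    have "S \<omega> \<noteq> {}" using \<open>c > 0\<close> by (auto simp: c_def)
    have Q: "c * (n * p / 2) \<le> Q (S \<omega>) \<omega>"
      using \<omega> sub c by (auto simp: F_def c_def)
    have "(9 / 10)\<^sup>2 \<le> (1 - p)\<^sup>2" using p by (intro power_mono) auto
    then have "3 / 4 * (n * p) * (9 / 10)\<^sup>2 \<le> c * (1 - p)\<^sup>2"
      using c \<open>c > 0\<close> np by (intro mult_mono) auto
    moreover have "n * p / 2 \<le> Q (S \<omega>) \<omega> / c"
      using Q \<open>c > 0\<close> by (simp add: field_simps)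
    ultimately have "n * p \<le> c * (1 - p)\<^sup>2 + Q (S \<omega>) \<omega> / c"
      using np by (simp add: power2_eq_square)
    then have "sqrt (n * p) \<le> sqrt (c * (1 - p)\<^sup>2 + Q (S \<omega>) \<omega> / c)"
      by simp
    also have "\<dots> \<le> spectral_norm k n (\<lambda>i. X i \<omega> - p)"
      unfolding c_def Q_def Y_def case_prod_conv
      by (rule spectral_norm_ge_support[OF assms(1) n(1) sub \<open>S \<omega> \<noteq> {}\<close>])
        (auto simp: S_def Y_def)
    finally show ?thesis using \<omega>(1) by simp
  qed
  then have "space M - ?G \<subseteq> ?B1 \<union> ?B2" by blast
  then have "prob (space M - ?G) \<le> prob (?B1 \<union> ?B2)"
    using B1_ev bad(1) by (intro finite_measure_mono) auto
  also have "\<dots> \<le> prob ?B1 + prob ?B2"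
    using B1_ev bad(1) by (rule measure_Un_le)
  also have "\<dots> \<le> 16 / (n * p) + \<delta>"
    using B1 bad(2) by simp
  finally show ?thesis
    unfolding prob_compl[OF G_ev] \<delta>_def by simp
qed

section \<open>Passage to the limit\<close>

theorem theorem2p3:
  fixes k :: nat
    and p :: "nat \<Rightarrow> real"
    and M :: "nat \<Rightarrow> 'a measure"
    and T :: "nat \<Rightarrow> (nat \<Rightarrow> nat) \<Rightarrow> 'a \<Rightarrow> real"
  assumes "k \<ge> 2"
    and "\<And>n. n \<ge> 1 \<Longrightarrow> 0 < p n \<and> p n < 1"
    and "\<And>n. n \<ge> 1 \<Longrightarrow> prob_space (M n)"
    and "\<And>n. n \<ge> 1 \<Longrightarrow>
           prob_space.indep_vars (M n) (\<lambda>_. borel) (T n) (multi_indices k n)"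
    and "\<And>n i. n \<ge> 1 \<Longrightarrow> i \<in> multi_indices k n \<Longrightarrow> bernoulli_var (M n) (p n) (T n i)"
    and "p \<longlonglongrightarrow> 0"
    and "filterlim (\<lambda>n. real n * p n) at_top sequentially"
  shows "(\<lambda>n. measure (M n) {\<omega> \<in> space (M n).
            spectral_norm k n (\<lambda>i. T n i \<omega> - (\<integral>\<omega>'. T n i \<omega>' \<partial>M n)) \<ge> sqrt (real n * p n)})
         \<longlonglongrightarrow> 1"
proof (rule tendsto_sandwich)
  let ?P = "\<lambda>n. measure (M n) {\<omega> \<in> space (M n).
    spectral_norm k n (\<lambda>i. T n i \<omega> - (\<integral>\<omega>'. T n i \<omega>' \<partial>M n)) \<ge> sqrt (real n * p n)}"
  let ?L = "\<lambda>n. 1 - (16 / (n * p n) + (64 / (3 * (n * p n)\<^sup>2) + 48 / n))"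
  have "eventually (\<lambda>n. p n < 1 / 10) sequentially"
    using assms(6) by (rule order_tendstoD) simp
  with eventually_ge_at_top[of 10] show "eventually (\<lambda>n. ?L n \<le> ?P n) sequentially"
  proof eventually_elim
    case (elim n)
    then have n: "n \<ge> 1" by simp
    interpret prob_space "M n" by (rule assms(3)[OF n])
    \<comment> \<open>The expectation is known to be \<open>p n\<close> only for genuine
      multi-indices, and the norm reads the tensor nowhere else.\<close>
    have "spectral_norm k n (\<lambda>i. T n i \<omega> - (\<integral>\<omega>'. T n i \<omega>' \<partial>M n)) =
        spectral_norm k n (\<lambda>i. T n i \<omega> - p n)" for \<omega>
    proof -
      have "(\<integral>\<omega>'. T n i \<omega>' \<partial>M n) = p n" if "i \<in> multi_indices k n" for i
        using expectation_bernoulli_var[OF assms(5)[OF n that]] assms(2)[OF n] by simp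
      then show ?thesis
        by (simp add: spectral_norm_def multilinear_form_def)
    qed
    then show ?case
      using spectral_norm_lower_bound_prob[OF assms(1) elim(1) assms(4,5)[OF n]] assms(2)[OF n] elim(2)
      by simp
  qed
  show "eventually (\<lambda>n. ?P n \<le> 1) sequentially"
    using eventually_ge_at_top[of 1]
    by eventually_elim (use assms(3) prob_space.prob_le_1 in blast)
  have a: "(\<lambda>n. 16 / (n * p n)) \<longlonglongrightarrow> 0"
    by (rule tendsto_divide_0[OF tendsto_const filterlim_at_top_imp_at_infinity[OF assms(7)]])
  \<comment> \<open>As 256 / 12 = 64 / 3, the quadratic error term is a multiple of the square of
    the first one and inherits its limit.\<close>
  have "(\<lambda>n. (16 / (n * p n))\<^sup>2 / 12) \<longlonglongrightarrow> 0\<^sup>2 / 12"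
    by (intro tendsto_intros a) simp
  moreover have "(\<lambda>n. (16 / (n * p n))\<^sup>2 / 12) = (\<lambda>n. 64 / (3 * (n * p n)\<^sup>2))"
    by (simp add: power_divide fun_eq_iff)
  ultimately have b: "(\<lambda>n. 64 / (3 * (n * p n)\<^sup>2)) \<longlonglongrightarrow> 0" by simp
  have "(\<lambda>n. 48 / real n) \<longlonglongrightarrow> 0"
    by (rule lim_const_over_n)
  then have "?L \<longlonglongrightarrow> 1 - (0 + (0 + 0))"
    by (intro tendsto_intros a b)
  then show "?L \<longlonglongrightarrow> 1" by simp
qed simp

end
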